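(* Let $r,\ell$ be positive integers. Whenever $\mathbf{N}$ is colored in $r$ colors, there are an infinite and apart set $X=\{x_1,x_2,\dots\}$ (listed in increasing order) of positive integers and positive integers $i_1,\dots,i_\ell$ such that all elements of $FS^{FS(\{i_1,\dots,i_\ell\})}(\{x_1,x_2,\dots\})$ have the same color.
   Context: $\mathbf{N}$ is the set of natural numbers. For a positive integer $n=2^{t_1}+\dots+2^{t_k}$ with $t_1<\dots<t_k$ let $\lambda(n)=t_1$ and $\mu(n)=t_k$. A set $X$ of positive integers is apart (satisfies the Apartness Condition) if for all $x,x'\in X$ with $x<x'$ we have $\mu(x)<\lambda(x')$. For a set $B\subseteq\mathbf{N}$, $FS(B)$ denotes the set of all non-empty finite sums of distinct elements of $B$. For a set $A$ of positive integers and a set $B\subseteq\mathbf{N}$, $FS^{A}(B)$ denotes the set of all sums of exactly $j$ distinct elements of $B$, for all $j\in A$. The integers $i_1,\dots,i_\ell$ are not required to be distinct. *)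

theory Defs
  imports Main "HOL-Library.Nat_Bijection"
begin

text \<open>\<^term>\<open>set_decode n\<close> is the set \<open>{t\<^sub>1, \<dots>, t\<^sub>k}\<close> of exponents in the
  binary expansion of \<open>n\<close>. Both functions below are only meaningful for \<open>n > 0\<close>.\<close>

lemma binary_expansion: "n = (\<Sum>t\<in>set_decode n. 2 ^ t)"
  by (metis set_decode_inverse set_encode_def)

definition lambda_exp :: "nat \<Rightarrow> nat" where
  "lambda_exp n = Min (set_decode n)"

definition mu_exp :: "nat \<Rightarrow> nat" where
  "mu_exp n = Max (set_decode n)"

definition apart :: "nat set \<Rightarrow> bool" where
  "apart X \<longleftrightarrow> (\<forall>x\<in>X. \<forall>x'\<in>X. x < x' \<longrightarrow> mu_exp x < lambda_exp x')"

definition FS :: "nat set \<Rightarrow> nat set" where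
  "FS B = {\<Sum>F |F. F \<subseteq> B \<and> finite F \<and> F \<noteq> {}}"

text \<open>Finite sums of an indexed family whose members need not be distinct: each index is
  used at most once, so a value occurring at several indices may be added several times
  (for a family of two equal members \<open>a\<close> the sums are \<open>a\<close> and \<open>a + a\<close>).\<close>

definition FS_fam :: "'i set \<Rightarrow> ('i \<Rightarrow> nat) \<Rightarrow> nat set" where
  "FS_fam J i = {\<Sum>j\<in>F. i j |F. F \<subseteq> J \<and> finite F \<and> F \<noteq> {}}"

lemma FS_fam_inj:
  assumes "inj_on i J"
  shows "FS_fam J i = FS (i ` J)"
proof -
  have eq: "\<Sum>(i ` F) = (\<Sum>j\<in>F. i j)" if "F \<subseteq> J" for F
    using sum.reindex[OF inj_on_subset[OF assms that], of "\<lambda>x. x"] by simp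
  show ?thesis
  proof (intro equalityI subsetI)
    fix s assume "s \<in> FS_fam J i"
    then obtain F where F: "F \<subseteq> J" "finite F" "F \<noteq> {}" "s = (\<Sum>j\<in>F. i j)"
      by (auto simp: FS_fam_def)
    then have "s = \<Sum>(i ` F)" "i ` F \<subseteq> i ` J" "finite (i ` F)" "i ` F \<noteq> {}"
      using eq by auto
    then show "s \<in> FS (i ` J)" unfolding FS_def by blast
  next
    fix s assume "s \<in> FS (i ` J)"
    then obtain G where G: "G \<subseteq> i ` J" "finite G" "G \<noteq> {}" "s = \<Sum>G"
      by (auto simp: FS_def)
    then obtain F where F: "F \<subseteq> J" "finite F" "G = i ` F"
      by (meson finite_subset_image)
    then have "s = (\<Sum>j\<in>F. i j)" "F \<noteq> {}" using eq G by auto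
    then show "s \<in> FS_fam J i" using F unfolding FS_fam_def by blast
  qed
qed

lemma FS_image_subset_FS_fam: "FS (i ` J) \<subseteq> FS_fam J i"
proof -
  obtain J' where J': "J' \<subseteq> J" "inj_on i J'" "i ` J' = i ` J"
    by (metis subset_image_inj order_refl)
  have "FS_fam J' i \<subseteq> FS_fam J i"
    using J'(1) unfolding FS_fam_def by blast
  then show ?thesis using FS_fam_inj[OF J'(2)] J'(3) by simp
qed

text \<open>\<open>FS\<^sup>A(B)\<close>: sums of exactly \<open>j\<close> distinct elements of \<open>B\<close>, for \<open>j \<in> A\<close>.\<close>

definition FS_card :: "nat set \<Rightarrow> nat set \<Rightarrow> nat set" where
  "FS_card A B = {\<Sum>F |F. F \<subseteq> B \<and> finite F \<and> card F \<in> A}"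

end

theory Submission
  imports Defs "HOL-Library.Ramsey"
begin

text \<open>Ramsey's theorem yields an infinite set of powers of two in which, for every
  \<open>j \<le> N\<close>, all sums of \<open>j\<close> distinct elements have one colour \<open>f j\<close>. Folkman's theorem,
  applied to the colouring \<open>f\<close>, yields the \<open>i\<^sub>j\<close>. Folkman's theorem is derived from
  van der Waerden's theorem, which is proved by colour focusing.\<close>

section \<open>Van der Waerden's theorem\<close>

text \<open>Progressions have \<open>k + 1\<close> terms and are listed downwards from their largest term. The
  condition \<open>d \<le> W\<close> matters only for \<open>k = 0\<close>, where the difference would be unbounded.\<close>

definition mono_ap :: "nat \<Rightarrow> nat \<Rightarrow> (nat \<Rightarrow> 'a) \<Rightarrow> bool" where
  "mono_ap k W c \<longleftrightarrow>
     (\<exists>a d. 0 < d \<and> d \<le> W \<and> k * d < a \<and> a \<le> W \<and> (\<forall>j\<le>k. c (a - j * d) = c a))"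

text \<open>The focus \<open>f\<close> is the missing term \<open>j = 0\<close> of every
  progression, and its own colour is left free. The size of \<open>T\<close> counts differently
  coloured progressions with this common focus.\<close>

definition focused :: "nat \<Rightarrow> nat \<Rightarrow> (nat \<Rightarrow> 'a) \<Rightarrow> nat \<Rightarrow> 'a set \<Rightarrow> bool" where
  "focused k W c f T \<longleftrightarrow> 0 < f \<and> f \<le> W \<and>
     (\<forall>y\<in>T. \<exists>d>0. k * d < f \<and> (\<forall>j\<in>{1..k}. c (f - j * d) = y))"

lemma mono_ap_shift:
  assumes "mono_ap k W (\<lambda>x. c (b + x))" and "b + W \<le> V"
  shows "mono_ap k V c"
proof -
  obtain a d where ad: "0 < d" "d \<le> W" "k * d < a" "a \<le> W"
      "\<And>j. j \<le> k \<Longrightarrow> c (b + (a - j * d)) = c (b + a)"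
    using assms(1) unfolding mono_ap_def by blast
  have "c (b + a - j * d) = c (b + a)" if "j \<le> k" for j
  proof -
    have "j * d \<le> k * d" using that by simp
    then have "b + a - j * d = b + (a - j * d)" using ad(3) by linarith
    then show ?thesis using ad(5)[OF that] by simp
  qed
  then show ?thesis
    unfolding mono_ap_def using ad assms(2)
    by (intro exI[of _ "b + a"] exI[of _ d]) auto
qed

lemma focused_imp_mono_ap:
  assumes "focused (Suc k) W c f T" and "c f \<in> T"
  shows "mono_ap (Suc k) W c"
proof -
  obtain d where d: "d > 0" "Suc k * d < f" "\<And>j. j \<in> {1..Suc k} \<Longrightarrow> c (f - j * d) = c f"
    using assms unfolding focused_def by blast
  have "d \<le> Suc k * d" by simp
  then have "d \<le> W" using d(2) assms(1) unfolding focused_def by linarith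
  moreover have "c (f - j * d) = c f" if "j \<le> Suc k" for j
    using d(3)[of j] that by (cases "j = 0") auto
  ultimately show ?thesis
    unfolding mono_ap_def using d assms(1) unfolding focused_def by blast
qed

text \<open>If the blocks \<open>b, b - e, \<dots>, b - k e\<close> of length \<open>W\<close> are coloured alike, a focus \<open>f\<close> in
  block \<open>b\<close> moves to block \<open>b + e\<close>, every difference grows by \<open>e W\<close>, and the
  progression of the copies of \<open>f\<close> contributes the colour of \<open>f\<close>.\<close>

lemma focused_extend:
  assumes foc: "focused (Suc k) W (\<lambda>x. c (b * W + x)) f T"
    and e: "0 < e" "k * e < b"
    and blocks: "\<And>j x. j \<le> k \<Longrightarrow> x \<le> W \<Longrightarrow> c ((b - j * e) * W + x) = c (b * W + x)"
    and V: "(b + e + 1) * W \<le> V"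
  shows "focused (Suc k) V c ((b + e) * W + f) (insert (c (b * W + f)) T)"
proof -
  have f: "0 < f" "f \<le> W" using foc by (auto simp: focused_def)
  have step: "c ((b + e) * W + f - j * (e * W + d)) = c (b * W + (f - j * d))"
    if j: "j \<in> {1..Suc k}" and d: "Suc k * d < f" for j d
  proof -
    \<comment> \<open>The focus lies in block \<open>b + e\<close>, so term \<open>j\<close> falls
      into block \<open>b - (j - 1) * e\<close>: the \<open>k + 1\<close> blocks coloured alike
      serve exactly the \<open>k + 1\<close> terms below the focus.\<close>
    obtain i where i: "j = Suc i" "i \<le> k" using j by (cases j) auto
    have "j * d \<le> Suc k * d" using j by (intro mult_right_mono) auto
    then have jd: "j * d \<le> f" using d by linarith
    have "i * e \<le> k * e" using i by simp
    then have ie: "i * e \<le> b" using e by linarith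
    then have "b + e = (b - i * e) + j * e" using i by simp
    then have "(b + e) * W = (b - i * e) * W + j * (e * W)"
      by (metis add_mult_distrib mult.assoc)
    then have "(b + e) * W + f - j * (e * W + d) = (b - i * e) * W + (f - j * d)"
      using jd by (simp add: add_mult_distrib2)
    then show ?thesis using blocks[OF i(2), of "f - j * d"] f by simp
  qed
  have bound: "Suc k * (e * W + d) < (b + e) * W + f" if "Suc k * d < f" for d
  proof -
    have "Suc k * e \<le> b + e" using e by simp
    then have "Suc k * e * W \<le> (b + e) * W" by (rule mult_right_mono) simp
    moreover have "Suc k * (e * W + d) = Suc k * e * W + Suc k * d"
      by (simp only: add_mult_distrib2 mult.assoc)
    ultimately show ?thesis using that by linarith
  qed
  have "\<exists>D>0. Suc k * D < (b + e) * W + f \<and>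
      (\<forall>j\<in>{1..Suc k}. c ((b + e) * W + f - j * D) = y)"
    if y: "y \<in> insert (c (b * W + f)) T" for y
  proof (cases "y = c (b * W + f)")
    case True
    then show ?thesis using step[of _ 0] bound[of 0] f e
      by (intro exI[of _ "e * W"]) auto
  next
    case False
    then obtain d where d: "d > 0" "Suc k * d < f"
        "\<And>j. j \<in> {1..Suc k} \<Longrightarrow> c (b * W + (f - j * d)) = y"
      using y foc unfolding focused_def by blast
    then show ?thesis using step[OF _ d(2)] bound[OF d(2)]
      by (intro exI[of _ "e * W + d"]) auto
  qed
  moreover have "(b + e) * W + f \<le> V" using V f by (simp add: algebra_simps)
  ultimately show ?thesis using f unfolding focused_def by simp
qed

text \<open>Induction on \<open>s\<close>: a progression of equally coloured blocks, which
  \<open>ap\<close> supplies with one term fewer, turns \<open>s\<close> colours focused inside a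
  block into \<open>s + 1\<close>. All finite colour sets occur in \<open>ap\<close> because blocks
  need many more colours than single numbers.\<close>

lemma focusing:
  fixes S :: "nat set"
  assumes S: "finite S"
    and ap: "\<And>S' :: nat set. finite S' \<Longrightarrow> \<exists>W. \<forall>c. range c \<subseteq> S' \<longrightarrow> mono_ap k W c"
  shows "\<exists>W. \<forall>c. range c \<subseteq> S \<longrightarrow> mono_ap (Suc k) W c \<or>
           (\<exists>f T. finite T \<and> card T = s \<and> T \<subseteq> S \<and> focused (Suc k) W c f T)"
proof (induction s)
  case 0
  show ?case
    by (intro exI[of _ 1] allI impI disjI2 exI[of _ "{}"]) (auto simp: focused_def)
next
  case (Suc s)
  then obtain W where W: "\<And>c. range c \<subseteq> S \<Longrightarrow> mono_ap (Suc k) W c \<or>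
      (\<exists>f T. finite T \<and> card T = s \<and> T \<subseteq> S \<and> focused (Suc k) W c f T)"
    by blast
  \<comment> \<open>The colour of a block is the word of its colours at positions 0 to
    \<open>W\<close>, coded as a natural number to fit \<open>ap\<close>.\<close>
  define S' where "S' = list_encode ` {xs. set xs \<subseteq> S \<and> length xs = Suc W}"
  have "finite S'"
    unfolding S'_def using finite_lists_length_eq[OF S] by simp
  then obtain W' where W': "\<And>c. range c \<subseteq> S' \<Longrightarrow> mono_ap k W' c"
    using ap by blast
  \<comment> \<open>Both \<open>b\<close> and \<open>e\<close> will be at most \<open>W'\<close>, so
    the block \<open>b + e\<close> that receives the new focus ends by \<open>V\<close>.\<close>
  define V where "V = (W' + W' + 1) * W"
  have "mono_ap (Suc k) V c \<or>
      (\<exists>f T. finite T \<and> card T = Suc s \<and> T \<subseteq> S \<and> focused (Suc k) V c f T)"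
    if c: "range c \<subseteq> S" for c
  proof -
    define C where "C = (\<lambda>n. list_encode (map (\<lambda>x. c (n * W + x)) [0..<Suc W]))"
    have "c x \<in> S" for x using c by auto
    then have "range C \<subseteq> S'" unfolding C_def S'_def by (auto simp del: upt_Suc intro!: imageI)
    then obtain b e where be: "0 < e" "e \<le> W'" "k * e < b" "b \<le> W'"
        "\<And>j. j \<le> k \<Longrightarrow> C (b - j * e) = C b"
      using W' unfolding mono_ap_def by blast
    have blocks: "c ((b - j * e) * W + x) = c (b * W + x)" if "j \<le> k" "x \<le> W" for j x
      using be(5)[OF that(1)] that(2) unfolding C_def
      by (auto simp del: upt_Suc simp: list_encode_eq map_eq_conv)
    have V: "(b + e + 1) * W \<le> V" unfolding V_def using be by (intro mult_right_mono) auto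
    have V': "b * W + W \<le> V" using V by (simp add: algebra_simps)
    let ?c = "\<lambda>x. c (b * W + x)"
    have "range ?c \<subseteq> S" using c by auto
    from W[OF this] consider "mono_ap (Suc k) W ?c"
      | f T where "finite T" "card T = s" "T \<subseteq> S" "focused (Suc k) W ?c f T"
      by blast
    then show ?thesis
    proof cases
      case 1
      then show ?thesis using mono_ap_shift V' by blast
    next
      case (2 f T)
      show ?thesis
      \<comment> \<open>A focus whose colour is already in \<open>T\<close> completes a progression;
        a new colour enlarges \<open>T\<close>.\<close>
      proof (cases "?c f \<in> T")
        case True
        then show ?thesis using focused_imp_mono_ap[OF 2(4)] mono_ap_shift V' by blast
      next
        case False
        have "focused (Suc k) V c ((b + e) * W + f) (insert (?c f) T)"
          using focused_extend[OF 2(4) be(1,3) blocks V] .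
        moreover have "finite (insert (?c f) T)" "card (insert (?c f) T) = Suc s"
          "insert (?c f) T \<subseteq> S" using 2 False c by auto
        ultimately show ?thesis by blast
      qed
    qed
  qed
  then show ?case by blast
qed

text \<open>Taking \<open>s = card S\<close> in \<open>focusing\<close> makes every colour focused,
  so the focus completes a progression whatever its colour.\<close>

theorem van_der_Waerden:
  fixes S :: "nat set"
  assumes "finite S"
  shows "\<exists>W. \<forall>c. range c \<subseteq> S \<longrightarrow> mono_ap k W c"
  using assms
proof (induction k arbitrary: S)
  case 0
  show ?case by (intro exI[of _ 1]) (auto simp: mono_ap_def)
next
  case (Suc k)
  obtain W where W: "\<And>c. range c \<subseteq> S \<Longrightarrow> mono_ap (Suc k) W c \<or>
      (\<exists>f T. finite T \<and> card T = card S \<and> T \<subseteq> S \<and> focused (Suc k) W c f T)"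
    using focusing[OF Suc.prems Suc.IH, of "card S"] by blast
  have "mono_ap (Suc k) W c" if c: "range c \<subseteq> S" for c
    using W[OF c]
  proof
    assume "\<exists>f T. finite T \<and> card T = card S \<and> T \<subseteq> S \<and> focused (Suc k) W c f T"
    then obtain f T where "card T = card S" "T \<subseteq> S" and foc: "focused (Suc k) W c f T"
      by blast
    then have "T = S" using Suc.prems by (simp add: card_subset_eq)
    then show ?thesis using focused_imp_mono_ap[OF foc] c by blast
  qed
  then show ?case by blast
qed

section \<open>Folkman's theorem\<close>

text \<open>The new number is the least term \<open>A\<close> of a progression with difference
  \<open>d\<close>, and the earlier numbers are multiplied by \<open>d\<close>. A sum that involves
  \<open>A\<close> is then \<open>A + d * m\<close> with \<open>m \<le> N\<close>, again a term of
  the progression. The bound \<open>N\<close>, uniform in \<open>c\<close>, tells how long a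
  progression the next step needs.\<close>

lemma sums_coloured_by_Max:
  fixes S :: "nat set"
  assumes "finite S"
  shows "\<exists>N. \<forall>c. range c \<subseteq> S \<longrightarrow> (\<exists>a :: nat \<Rightarrow> nat. (\<forall>i<n. 0 < a i) \<and>
           (\<forall>F\<subseteq>{..<n}. F \<noteq> {} \<longrightarrow> sum a F \<le> N \<and> c (sum a F) = c (a (Max F))))"
proof (induction n)
  case 0
  show ?case by auto
next
  case (Suc n)
  then obtain N where N: "\<And>c. range c \<subseteq> S \<Longrightarrow> \<exists>a :: nat \<Rightarrow> nat. (\<forall>i<n. 0 < a i) \<and>
      (\<forall>F\<subseteq>{..<n}. F \<noteq> {} \<longrightarrow> sum a F \<le> N \<and> c (sum a F) = c (a (Max F)))"
    by blast
  obtain W where W: "\<And>c. range c \<subseteq> S \<Longrightarrow> mono_ap N W c"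
    using van_der_Waerden[OF assms] by blast
  have "\<exists>a :: nat \<Rightarrow> nat. (\<forall>i<Suc n. 0 < a i) \<and>
      (\<forall>F\<subseteq>{..<Suc n}. F \<noteq> {} \<longrightarrow> sum a F \<le> W \<and> c (sum a F) = c (a (Max F)))"
    if c: "range c \<subseteq> S" for c
  proof -
    obtain u d where u: "0 < d" "N * d < u" "u \<le> W" "\<And>j. j \<le> N \<Longrightarrow> c (u - j * d) = c u"
      using W[OF c] unfolding mono_ap_def by blast
    define A where "A = u - N * d"
    have A: "c (A + d * m) = c A" "A + d * m \<le> W" if "m \<le> N" for m
    proof -
      have "N * d = (N - m) * d + m * d" using that by (simp flip: add_mult_distrib)
      then have "A + d * m = u - (N - m) * d"
        using u(2) unfolding A_def by (simp add: mult.commute)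
      then show "c (A + d * m) = c A" "A + d * m \<le> W"
        using u(3) u(4)[of "N - m"] u(4)[of N] unfolding A_def by auto
    qed
    \<comment> \<open>Numbers good for the dilated colouring become good for \<open>c\<close> when
      multiplied by \<open>d\<close>.\<close>
    have "range (\<lambda>x. c (d * x)) \<subseteq> S" using c by auto
    from N[OF this] obtain a where a: "\<And>i. i < n \<Longrightarrow> 0 < a i"
        "\<And>F. F \<subseteq> {..<n} \<Longrightarrow> F \<noteq> {} \<Longrightarrow> sum a F \<le> N \<and> c (d * sum a F) = c (d * a (Max F))"
      by blast
    define a' where "a' = (\<lambda>i. if i < n then d * a i else A)"
    have sum_a': "sum a' F = d * sum a F" if "F \<subseteq> {..<n}" for F
      unfolding sum_distrib_left a'_def using that by (intro sum.cong) auto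
    have "sum a' F \<le> W \<and> c (sum a' F) = c (a' (Max F))"
      if F: "F \<subseteq> {..<Suc n}" "F \<noteq> {}" for F
    proof (cases "n \<in> F")
      case True
      have fin: "finite F" using F(1) finite_subset by blast
      have Fn: "F - {n} \<subseteq> {..<n}" using F(1) by auto
      have "Max F = n" using F(1) True fin by (intro Max_eqI) auto
      then have max: "a' (Max F) = A" by (simp add: a'_def)
      have "sum a' F = A + d * sum a (F - {n})"
        using sum.remove[OF fin True, of a'] sum_a'[OF Fn] by (simp add: a'_def)
      \<comment> \<open>For \<open>F = {n}\<close> this is the empty sum 0, which
        \<open>a(2)\<close> does not cover.\<close>
      moreover have "sum a (F - {n}) \<le> N"
        using a(2)[OF Fn] by (metis le0 sum.empty)
      ultimately show ?thesis using A max by simp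
    next
      case False
      then have Fn: "F \<subseteq> {..<n}" using F(1) by (auto simp: less_Suc_eq)
      then have "Max F < n" using F(2) finite_subset[OF Fn]
        by (metis Max_in finite_lessThan lessThan_iff subsetD)
      moreover have "d * sum a F \<le> W"
      proof -
        have "d * sum a F \<le> d * N" using a(2)[OF Fn F(2)] by simp
        also have "\<dots> \<le> W" using u by (simp add: mult.commute)
        finally show ?thesis .
      qed
      ultimately show ?thesis
        using sum_a'[OF Fn] a(2)[OF Fn F(2)] by (simp add: a'_def)
    qed
    moreover have "0 < a' i" if "i < Suc n" for i
      using a(1) u(1,2) unfolding a'_def A_def by simp
    ultimately show ?thesis by blast
  qed
  then show ?case by blast
qed

lemma pigeonhole_class:
  assumes "finite A" "finite S" "f ` A \<subseteq> S" "card S * l < card A"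
  obtains y where "l < card {x \<in> A. f x = y}"
proof -
  have "card A = (\<Sum>y\<in>S. card {x \<in> A. f x = y})"
    using sum.group[OF assms(1-3), of "\<lambda>_. 1 :: nat"] by simp
  then have "\<not> (\<forall>y\<in>S. card {x \<in> A. f x = y} \<le> l)"
    using sum_bounded_above[of S "\<lambda>y. card {x \<in> A. f x = y}" l] assms(4) by auto
  then show ?thesis using that by (meson not_le)
qed

text \<open>By pigeonhole, \<open>l\<close> of the numbers from \<open>sums_coloured_by_Max\<close>
  share a colour, and the largest index of a sum of these is again one of theirs. The bound
  \<open>N\<close> lets Ramsey's theorem be used for finitely many cardinalities only.\<close>

theorem Folkman:
  fixes S :: "nat set"
  assumes "finite S"
  shows "\<exists>N. \<forall>c. range c \<subseteq> S \<longrightarrow> (\<exists>i :: nat \<Rightarrow> nat. (\<forall>j\<in>{1..l}. 0 < i j) \<and>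
           (\<exists>y. \<forall>s \<in> FS_fam {1..l} i. s \<le> N \<and> c s = y))"
proof -
  define n where "n = Suc (card S * l)"
  obtain N where N: "\<And>c. range c \<subseteq> S \<Longrightarrow> \<exists>a :: nat \<Rightarrow> nat. (\<forall>i<n. 0 < a i) \<and>
      (\<forall>F\<subseteq>{..<n}. F \<noteq> {} \<longrightarrow> sum a F \<le> N \<and> c (sum a F) = c (a (Max F)))"
    using sums_coloured_by_Max[OF assms] by blast
  have "\<exists>i :: nat \<Rightarrow> nat. (\<forall>j\<in>{1..l}. 0 < i j) \<and>
      (\<exists>y. \<forall>s \<in> FS_fam {1..l} i. s \<le> N \<and> c s = y)" if c: "range c \<subseteq> S" for c
  proof -
    obtain a where a: "\<And>i. i < n \<Longrightarrow> 0 < a i"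
        "\<And>F. F \<subseteq> {..<n} \<Longrightarrow> F \<noteq> {} \<Longrightarrow> sum a F \<le> N \<and> c (sum a F) = c (a (Max F))"
      using N[OF c] by blast
    obtain y where "l < card {i \<in> {..<n}. c (a i) = y}"
      by (rule pigeonhole_class[of "{..<n}" S "\<lambda>i. c (a i)" l])
        (use assms c in \<open>auto simp: n_def\<close>)
    then obtain J where J: "J \<subseteq> {i \<in> {..<n}. c (a i) = y}" "card J = l"
      by (meson less_imp_le obtain_subset_with_card_n)
    have "J \<subseteq> {..<n}" using J(1) by auto
    then have "finite J" by (rule finite_subset) simp
    then obtain h where h: "bij_betw h {1..l} J"
      using J(2) by (metis ex_bij_betw_nat_finite_1)
    \<comment> \<open>The indices \<open>h j\<close> are distinct while the values
      \<open>a (h j)\<close> may coincide, hence sums of a family.\<close>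
    have "s \<le> N \<and> c s = y" if s: "s \<in> FS_fam {1..l} (a \<circ> h)" for s
    proof -
      obtain F where F: "F \<subseteq> {1..l}" "finite F" "F \<noteq> {}" "s = (\<Sum>j\<in>F. a (h j))"
        using s unfolding FS_fam_def by auto
      have "inj_on h F" using h F(1) by (meson bij_betw_imp_inj_on inj_on_subset)
      then have s': "s = sum a (h ` F)" using F(4) by (simp add: sum.reindex)
      have hF: "h ` F \<subseteq> J" using h F(1) by (auto simp: bij_betw_def)
      then have "h ` F \<subseteq> {..<n}" using J(1) by auto
      from a(2)[OF this] have "s \<le> N" "c s = c (a (Max (h ` F)))" using s' F(3) by auto
      moreover have "Max (h ` F) \<in> J" using hF F(2,3)
        by (meson Max_in finite_imageI image_is_empty subsetD)
      ultimately show ?thesis using J(1) by auto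
    qed
    moreover have "0 < (a \<circ> h) j" if "j \<in> {1..l}" for j
      using bij_betw_apply[OF h that] J(1) a(1) by auto
    ultimately show ?thesis by blast
  qed
  then show ?thesis by blast
qed

section \<open>Colours depending only on the cardinality\<close>

text \<open>Ramsey's theorem is applied to one cardinality after another; what holds for smaller
  ones survives in the infinite subset.\<close>

lemma Ramsey_upto:
  fixes g :: "nat set \<Rightarrow> nat"
  assumes "\<And>F. g F < r"
  shows "\<exists>Y f. infinite Y \<and> (\<forall>j. f j < r) \<and>
           (\<forall>F. F \<subseteq> Y \<and> finite F \<and> card F \<le> N \<longrightarrow> g F = f (card F))"
proof (induction N)
  case 0
  show ?case
    \<comment> \<open>Only the empty set counts here; elsewhere \<open>g {}\<close> is a default
      that keeps \<open>f\<close> an \<open>r\<close>-colouring of all numbers.\<close>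
    using assms by (intro exI[of _ UNIV] exI[of _ "\<lambda>_. g {}"]) auto
next
  case (Suc N)
  then obtain Y f where Y: "infinite Y" "\<forall>j. f j < r"
      "\<forall>F. F \<subseteq> Y \<and> finite F \<and> card F \<le> N \<longrightarrow> g F = f (card F)"
    by (elim exE conjE) (rule that)
  have "\<forall>F. F \<subseteq> Y \<and> finite F \<and> card F = Suc N \<longrightarrow> g F < r" using assms by simp
  from Ramsey[OF Y(1) this] obtain Z t where Z: "Z \<subseteq> Y" "infinite Z" "t < r"
      "\<forall>F. F \<subseteq> Z \<and> finite F \<and> card F = Suc N \<longrightarrow> g F = t"
    by (elim exE conjE) (rule that)
  have "g F = (f(Suc N := t)) (card F)" if "F \<subseteq> Z" "finite F" "card F \<le> Suc N" for F
    using that Y(3)[rule_format, of F] Z(1,4) by (cases "card F = Suc N") auto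
  moreover have "(f(Suc N := t)) j < r" for j using Y(2) Z(3) by simp
  ultimately show ?case
    using Z(2) by (intro exI[of _ Z] exI[of _ "f(Suc N := t)"]) blast
qed

lemma set_decode_two_power: "set_decode (2 ^ t) = {t}"
  using set_encode_inverse[of "{t}"] by (simp add: set_encode_def)

lemma apart_two_powers: "apart ((^) 2 ` Y)"
  by (auto simp: apart_def lambda_exp_def mu_exp_def set_decode_two_power)

theorem mainTheorem9:
  fixes r l :: nat and c :: "nat \<Rightarrow> nat"
  assumes "r > 0" and "l > 0"
    and "\<forall>n. c n < r"
  shows "\<exists>(X :: nat set) (i :: nat \<Rightarrow> nat).
           infinite X \<and> (\<forall>x\<in>X. x > 0) \<and> apart X \<and>
           (\<forall>j\<in>{1..l}. i j > 0) \<and>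
           (\<exists>k. \<forall>s \<in> FS_card (FS_fam {1..l} i) X. c s = k)"
proof -
  \<comment> \<open>\<open>N\<close> depends on \<open>r\<close> and \<open>l\<close> alone, so it
    can be fixed before Ramsey's theorem produces the colouring \<open>f\<close>.\<close>
  obtain N where N: "\<And>f. range f \<subseteq> {..<r} \<Longrightarrow> \<exists>i :: nat \<Rightarrow> nat. (\<forall>j\<in>{1..l}. 0 < i j) \<and>
      (\<exists>y. \<forall>s \<in> FS_fam {1..l} i. s \<le> N \<and> f s = y)"
    using Folkman[of "{..<r}" l] by blast
  \<comment> \<open>A finite set of exponents gets the colour of the sum of its powers of two, which
    is \<open>set_encode F\<close>.\<close>
  have "c (set_encode F) < r" for F using assms(3) by simp
  from Ramsey_upto[of "\<lambda>F. c (set_encode F)" r N, OF this]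
  obtain Y f where Y: "infinite Y" "\<forall>j. f j < r"
      "\<forall>F. F \<subseteq> Y \<and> finite F \<and> card F \<le> N \<longrightarrow> c (set_encode F) = f (card F)"
    by (elim exE conjE) (rule that)
  have "range f \<subseteq> {..<r}" using Y(2) by auto
  from N[OF this] obtain i :: "nat \<Rightarrow> nat" and y where i: "\<forall>j\<in>{1..l}. 0 < i j"
      "\<And>s. s \<in> FS_fam {1..l} i \<Longrightarrow> s \<le> N \<and> f s = y"
    by blast
  define X :: "nat set" where "X = (^) 2 ` Y"
  have inj: "inj_on ((^) (2 :: nat)) A" for A by (auto simp: inj_on_def)
  have "c s = y" if s: "s \<in> FS_card (FS_fam {1..l} i) X" for s
  proof -
    obtain F where F: "F \<subseteq> X" "finite F" "card F \<in> FS_fam {1..l} i" "s = \<Sum>F"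
      using s unfolding FS_card_def by blast
    obtain G where G: "G \<subseteq> Y" "finite G" "F = (^) 2 ` G"
      using F(1,2) unfolding X_def by (meson finite_subset_image)
    have "card F = card G" using G(3) inj by (simp add: card_image)
    moreover have "s = set_encode G"
      using F(4) G(3) inj by (simp add: sum.reindex set_encode_def)
    ultimately show ?thesis using Y(3) G(1,2) i(2) F(3) by auto
  qed
  moreover have "infinite X" unfolding X_def using Y(1) inj by (simp add: finite_image_iff)
  moreover have "\<forall>x\<in>X. x > 0" "apart X" unfolding X_def by (simp_all add: apart_two_powers)
  ultimately show ?thesis
    using i(1) by (intro exI[of _ X] exI[of _ i] exI[of _ y] conjI ballI) auto
qed

end
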